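(* For each integer $n\geq 2$, let $G_{2n+1}$ be the graph obtained from the complete graph $K_{2n+1}$ by choosing two vertices $u$ and $v$, subdividing the edge $uv$ with a new vertex $x$ (so the edge $uv$ is replaced by the two edges $ux$ and $xv$), and then attaching $2n-2$ pendant vertices to $x$. Then for every $n\geq 2$, the graph $G_{2n+1}$ is not opposable, and the second player wins SNORT on $G_{2n+1}$.
   Context: All graphs are finite and simple. $N[v]$ denotes the closed neighbourhood of $v$. An opposition of a graph $G$ is an automorphism $f$ of $G$ of order two, in the sense $f\circ f=\mathrm{id}$, such that $f(v)\notin N[v]$ for all $v\in V(G)$. A graph is opposable if it has an opposition. SNORT on a graph $G$: two players, Left and Right, move alternately; all vertices start uncoloured. On her turn Left colours an uncoloured vertex blue that is not adjacent to any red vertex; on his turn Right colours an uncoloured vertex red that is not adjacent to any blue vertex. A player unable to move on their turn loses. "The second player wins SNORT on $G$" means that the player who moves second has a winning strategy (by symmetry this does not depend on whether Left or Right starts). *)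

theory Defs
  imports "Graph_Theory.Graph_Theory"
begin

text \<open>
  Finite simple graphs are the symmetric, loop-free, finite digraphs of the locale
  \<^locale>\<open>pair_graph\<close>: every edge is represented by its two arcs. Subdivision of an edge is
  \<^const>\<open>subdivide\<close>, and \<^const>\<open>complete_digraph\<close> says that a graph is a complete graph on the
  given number of vertices.
\<close>

section \<open>The graphs\<close>

definition attach_pendants :: "'a pair_pre_digraph \<Rightarrow> 'a \<Rightarrow> 'a set \<Rightarrow> 'a pair_pre_digraph" where
  "attach_pendants G x P =
    \<lparr> pverts = pverts G \<union> P, parcs = parcs G \<union> {x} \<times> P \<union> P \<times> {x} \<rparr>"

text \<open>
  The intended arguments are a complete graph \<open>K\<close>, two of its vertices \<open>u \<noteq> v\<close>, a new vertex
  \<open>x\<close>, and a set \<open>P\<close> of further new vertices.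
\<close>

definition pendant_subdivision ::
  "'a pair_pre_digraph \<Rightarrow> 'a \<Rightarrow> 'a \<Rightarrow> 'a \<Rightarrow> 'a set \<Rightarrow> 'a pair_pre_digraph" where
  "pendant_subdivision K u v x P = attach_pendants (subdivide K (u, v) x) x P"

lemma pair_graph_pendant_subdivision:
  assumes K: "complete_digraph k (with_proj K)"
    and "u \<in> pverts K" "v \<in> pverts K" "u \<noteq> v" "x \<notin> pverts K"
    and "finite P" "P \<inter> insert x (pverts K) = {}"
  shows "pair_graph (pendant_subdivision K u v x P)"
proof -
  interpret pair_graph K using K by (rule pair_graphI_complete)
  have fin: "finite (pverts K)" and "finite (parcs K)"
    using pair_finite_verts pair_finite_arcs by auto
  with assms(2-) show ?thesis
    by unfold_locales
      (auto simp: pendant_subdivision_def attach_pendants_def symmetric_def no_loops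
        intro!: symI dest: arcs_symmetric arc_fst_in_verts arc_snd_in_verts pair_no_loops)
qed


section \<open>Oppositions\<close>

definition closed_nbhd :: "'a pair_pre_digraph \<Rightarrow> 'a \<Rightarrow> 'a set" where
  "closed_nbhd G v = insert v {w. (v, w) \<in> parcs G}"

definition automorphism :: "'a pair_pre_digraph \<Rightarrow> ('a \<Rightarrow> 'a) \<Rightarrow> bool" where
  "automorphism G f \<longleftrightarrow> bij_betw f (pverts G) (pverts G) \<and>
    (\<forall>a\<in>pverts G. \<forall>b\<in>pverts G. (f a, f b) \<in> parcs G \<longleftrightarrow> (a, b) \<in> parcs G)"

definition opposition :: "'a pair_pre_digraph \<Rightarrow> ('a \<Rightarrow> 'a) \<Rightarrow> bool" where
  "opposition G f \<longleftrightarrow> automorphism G f \<and> (\<forall>v\<in>pverts G. f (f v) = v) \<and>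
    (\<forall>v\<in>pverts G. f v \<notin> closed_nbhd G v)"

definition opposable :: "'a pair_pre_digraph \<Rightarrow> bool" where
  "opposable G \<longleftrightarrow> (\<exists>f. opposition G f)"


section \<open>SNORT\<close>

datatype player = Left | Right

fun opponent :: "player \<Rightarrow> player" where
  "opponent Left = Right"
| "opponent Right = Left"

text \<open>
  Colours are identified with the players using them: \<open>Left\<close> is blue and \<open>Right\<close> is red. A partial
  colouring maps the uncoloured vertices to \<^const>\<open>None\<close>.
\<close>

type_synonym 'a colouring = "'a \<Rightarrow> player option"

definition legal_move :: "'a pair_pre_digraph \<Rightarrow> player \<Rightarrow> 'a colouring \<Rightarrow> 'a \<Rightarrow> bool" where
  "legal_move G p c w \<longleftrightarrow> w \<in> pverts G \<and> c w = None \<and>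
    (\<forall>y. (w, y) \<in> parcs G \<longrightarrow> c y \<noteq> Some (opponent p))"

text \<open>
  \<open>strategy_wins G p \<sigma> q c\<close>: player \<open>p\<close>, moving according to \<open>\<sigma>\<close>, wins every play from
  the colouring \<open>c\<close> with \<open>q\<close> to move. There is no separate base case: the second rule
  applies in particular when the opponent has no legal move, whereas neither rule applies when
  it is the turn of \<open>p\<close> and \<open>\<sigma>\<close> gives no legal move.
\<close>

inductive strategy_wins ::
  "'a pair_pre_digraph \<Rightarrow> player \<Rightarrow> ('a colouring \<Rightarrow> 'a) \<Rightarrow> player \<Rightarrow> 'a colouring \<Rightarrow> bool"
  for G :: "'a pair_pre_digraph" and p :: player and \<sigma> :: "'a colouring \<Rightarrow> 'a" where
  own_turn: "strategy_wins G p \<sigma> p c"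
    if "legal_move G p c (\<sigma> c)" and "strategy_wins G p \<sigma> (opponent p) (c(\<sigma> c \<mapsto> p))"
| opponent_turn: "strategy_wins G p \<sigma> (opponent p) c"
    if "\<And>w. legal_move G (opponent p) c w \<Longrightarrow> strategy_wins G p \<sigma> p (c(w \<mapsto> opponent p))"

definition second_player_wins_snort :: "'a pair_pre_digraph \<Rightarrow> bool" where
  "second_player_wins_snort G \<longleftrightarrow>
    (\<forall>starter. \<exists>\<sigma>. strategy_wins G (opponent starter) \<sigma> starter Map.empty)"

end

theory Submission
  imports Defs
begin

text \<open>
  An opposition would send \<open>x\<close> to a vertex of the complete part, and hence a pendant vertex to a
  neighbour of that vertex; but all such neighbours have degree greater than one.

  In SNORT the second player answers \<open>x\<close> by a vertex outside \<open>{u, v}\<close> of the complete part and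
  vice versa, answers \<open>u\<close> by \<open>v\<close> and vice versa, and answers a pendant vertex by \<open>u\<close> and then takes
  \<open>v\<close> or, if \<open>v\<close> was just played, a further pendant vertex. After this opening no move of one
  player restricts the other one, and it only remains to count the available moves.
\<close>

section \<open>Legal moves, and strategies from an invariant\<close>

lemma opponent_opponent [simp]: "opponent (opponent p) = p"
  by (cases p) auto

lemma opponent_neq [simp]: "opponent p \<noteq> p" "p \<noteq> opponent p"
  by (cases p; simp)+

lemma legal_move_empty [simp]: "legal_move G p Map.empty w \<longleftrightarrow> w \<in> pverts G"
  by (simp add: legal_move_def)

text \<open>Colouring a fresh vertex only adds constraints; if \<open>y\<close> already carried the
  colour of \<open>opponent p\<close>, recolouring it could lift one.\<close>

lemma legal_move_update:
  assumes "c y = None"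
  shows "legal_move G p (c(y \<mapsto> q)) w \<longleftrightarrow>
    legal_move G p c w \<and> w \<noteq> y \<and> (q = opponent p \<longrightarrow> (w, y) \<notin> parcs G)"
proof -
  have "(c(y \<mapsto> q)) z \<noteq> Some (opponent p) \<longleftrightarrow>
    c z \<noteq> Some (opponent p) \<and> (z = y \<longrightarrow> q \<noteq> opponent p)" for z
    using assms by simp
  moreover have "(c(y \<mapsto> q)) w = None \<longleftrightarrow> c w = None \<and> w \<noteq> y"
    by simp
  ultimately show ?thesis unfolding legal_move_def by blast
qed

text \<open>\<open>I\<close> is an invariant of the positions with \<open>opponent p\<close> to
  move. Each round colours two more vertices, so play ends, and it ends on a turn of
  \<open>opponent p\<close> because \<open>p\<close> always has a reply.\<close>

lemma ex_winning_strategy: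
  assumes fin: "finite (pverts G)" and "I c"
    and reply: "\<And>c w. I c \<Longrightarrow> legal_move G (opponent p) c w \<Longrightarrow>
      \<exists>z. legal_move G p (c(w \<mapsto> opponent p)) z \<and> I (c(w \<mapsto> opponent p, z \<mapsto> p))"
  shows "\<exists>\<sigma>. strategy_wins G p \<sigma> (opponent p) c"
proof -
  define \<sigma> where "\<sigma> c = (SOME z. legal_move G p c z \<and> I (c(z \<mapsto> p)))" for c
  have "strategy_wins G p \<sigma> (opponent p) c" if "I c" for c
    using that
  proof (induction "card {w \<in> pverts G. c w = None}" arbitrary: c rule: less_induct)
    case less
    show ?case
    proof (rule strategy_wins.opponent_turn)
      fix w assume w: "legal_move G (opponent p) c w"
      define d where "d = c(w \<mapsto> opponent p)"
      have \<sigma>: "legal_move G p d (\<sigma> d)" "I (d(\<sigma> d \<mapsto> p))"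
        using someI_ex[OF reply[OF less.prems w]] by (auto simp: \<sigma>_def d_def)
      have "{w \<in> pverts G. (d(\<sigma> d \<mapsto> p)) w = None} \<subset> {w \<in> pverts G. c w = None}"
        using w by (auto simp: d_def legal_move_def split: if_splits)
      then have "card {w \<in> pverts G. (d(\<sigma> d \<mapsto> p)) w = None} < card {w \<in> pverts G. c w = None}"
        using fin by (intro psubset_card_mono) auto
      then have "strategy_wins G p \<sigma> (opponent p) (d(\<sigma> d \<mapsto> p))"
        using less.hyps \<sigma>(2) by blast
      with \<sigma>(1) have "strategy_wins G p \<sigma> p d"
        by (rule strategy_wins.own_turn)
      then show "strategy_wins G p \<sigma> p (c(w \<mapsto> opponent p))"
        by (simp add: d_def)
    qed
  qed
  with \<open>I c\<close> show ?thesis by blast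
qed

section \<open>Balanced positions\<close>

definition moves :: "'a pair_pre_digraph \<Rightarrow> player \<Rightarrow> 'a colouring \<Rightarrow> 'a set" where
  "moves G p c = {w. legal_move G p c w}"

text \<open>
  The moves available to both players form an even heap of tempo moves, so the player \<open>p\<close>, who is
  not on turn, can always answer in kind.
\<close>

definition balanced :: "'a pair_pre_digraph \<Rightarrow> player \<Rightarrow> 'a colouring \<Rightarrow> bool" where
  "balanced G p c \<longleftrightarrow>
    (\<forall>a\<in>moves G (opponent p) c. \<forall>b\<in>moves G p c. (a, b) \<notin> parcs G \<and> (b, a) \<notin> parcs G) \<and>
    card (moves G (opponent p) c - moves G p c) \<le> card (moves G p c - moves G (opponent p) c) \<and>
    even (card (moves G (opponent p) c \<inter> moves G p c))"

text \<open>By separation no move closes anything else for the other side, so only counting remains: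
  a shared move is answered by a shared one, a private move by a private one.\<close>

lemma balanced_reply:
  assumes fin: "finite (pverts G)" and bal: "balanced G p c"
    and w: "legal_move G (opponent p) c w"
  shows "\<exists>z. legal_move G p (c(w \<mapsto> opponent p)) z \<and> balanced G p (c(w \<mapsto> opponent p, z \<mapsto> p))"
proof -
  define S where "S = moves G (opponent p) c"
  define T where "T = moves G p c"
  have finS: "finite S" and finT: "finite T"
    using fin by (auto simp: S_def T_def moves_def legal_move_def intro: finite_subset[of _ "pverts G"])
  have sep: "(a, b) \<notin> parcs G" "(b, a) \<notin> parcs G" if "a \<in> S" "b \<in> T" for a b
    using bal that by (auto simp: balanced_def S_def T_def)
  have le: "card (S - T) \<le> card (T - S)" and ev: "even (card (S \<inter> T))"
    using bal by (auto simp: balanced_def S_def T_def)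
  have wS: "w \<in> S" using w by (simp add: S_def moves_def)
  have none: "c y = None" if "y \<in> S \<union> T" for y
    using that by (auto simp: S_def T_def moves_def legal_move_def)
  have legal: "legal_move G p (c(w \<mapsto> opponent p)) z" if "z \<in> T" "z \<noteq> w" for z
    using that sep wS none by (auto simp: legal_move_update T_def moves_def)
  have S': "moves G (opponent p) (c(w \<mapsto> opponent p, z \<mapsto> p)) = S - {w, z}"
    and T': "moves G p (c(w \<mapsto> opponent p, z \<mapsto> p)) = T - {w, z}" if "z \<in> T" "z \<noteq> w" for z
    using that sep wS none
    by (auto simp: moves_def legal_move_update S_def T_def)
  have "\<exists>z\<in>T. z \<noteq> w \<and> card (S - {w, z} - (T - {w, z})) \<le> card (T - {w, z} - (S - {w, z})) \<and>
    even (card ((S - {w, z}) \<inter> (T - {w, z})))"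
  proof (cases "w \<in> T")
    case True
    \<comment> \<open>An even set containing \<open>w\<close> has a second element.\<close>
    have "S \<inter> T - {w} \<noteq> {}"
    proof
      assume "S \<inter> T - {w} = {}"
      then have "S \<inter> T = {w}" using wS True by auto
      then show False using ev by simp
    qed
    then obtain z where z: "z \<in> S" "z \<in> T" "z \<noteq> w" by auto
    have 1: "S - {w, z} - (T - {w, z}) = S - T" "T - {w, z} - (S - {w, z}) = T - S"
      "(S - {w, z}) \<inter> (T - {w, z}) = S \<inter> T - {w, z}"
      using wS True z by auto
    have "card (S \<inter> T - {w, z}) = card (S \<inter> T) - 2"
      using wS True z finS by (subst card_Diff_subset) auto
    with z ev le show ?thesis unfolding 1[symmetric]
      by (intro bexI[of _ z]) (simp_all add: 1)
  next
    case False
    then have "w \<in> S - T" using wS by simp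
    \<comment> \<open>The move \<open>w\<close> is private to \<open>opponent p\<close>, and
      \<open>p\<close> has at least as many private moves.\<close>
    then have "0 < card (S - T)" using finS card_gt_0_iff by blast
    then have "0 < card (T - S)" using le by simp
    then have "T - S \<noteq> {}" by (metis card.empty less_irrefl)
    then obtain z where z: "z \<in> T" "z \<notin> S" by blast
    have 1: "S - {w, z} - (T - {w, z}) = S - T - {w}" "T - {w, z} - (S - {w, z}) = T - S - {z}"
      "(S - {w, z}) \<inter> (T - {w, z}) = S \<inter> T"
      using wS False z by auto
    have "card (S - T - {w}) \<le> card (T - S - {z})"
      using le wS False z finS finT by (simp add: card_Diff_singleton)
    with z ev wS show ?thesis
      by (intro bexI[of _ z]) (auto simp: 1)
  qed
  then obtain z where "z \<in> T" "z \<noteq> w"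
    and "card (S - {w, z} - (T - {w, z})) \<le> card (T - {w, z} - (S - {w, z}))"
    and "even (card ((S - {w, z}) \<inter> (T - {w, z})))" by blast
  moreover from this have "balanced G p (c(w \<mapsto> opponent p, z \<mapsto> p))"
    using sep by (simp add: balanced_def S' T')
  ultimately show ?thesis using legal by blast
qed

section \<open>Vertices, arcs and counts of the graph\<close>

locale complete_pendant_subdivision =
  fixes n :: nat and K :: "'a pair_pre_digraph" and u v x :: 'a and P :: "'a set"
  assumes n: "n \<ge> 2"
    and complete: "complete_digraph (2 * n + 1) (with_proj K)"
    and u: "u \<in> pverts K" and v: "v \<in> pverts K" and uv: "u \<noteq> v"
    and x: "x \<notin> pverts K"
    and finP: "finite P" and cardP: "card P = 2 * n - 2" and P: "P \<inter> insert x (pverts K) = {}"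
begin

abbreviation G where "G \<equiv> pendant_subdivision K u v x P"

abbreviation W where "W \<equiv> pverts K - {u, v}"

lemma finK: "finite (pverts K)"
  using complete n by (auto simp: complete_digraph_def intro: card_ge_0_finite)

lemma cardW: "card W = 2 * n - 1"
  using complete u v uv finK by (subst card_Diff_subset) (auto simp: complete_digraph_def)

lemma verts_G: "pverts G = insert x (pverts K \<union> P)"
  by (auto simp: pendant_subdivision_def attach_pendants_def)

lemma finG: "finite (pverts G)"
  using finK finP by (simp add: verts_G)

lemma arcs_G: "(a, b) \<in> parcs G \<longleftrightarrow>
    a \<in> pverts K \<and> b \<in> pverts K \<and> a \<noteq> b \<and> (a, b) \<noteq> (u, v) \<and> (a, b) \<noteq> (v, u) \<or>
    a = x \<and> b \<in> {u, v} \<union> P \<or> b = x \<and> a \<in> {u, v} \<union> P"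
  using complete by (auto simp: pendant_subdivision_def attach_pendants_def complete_digraph_def)

lemma distinctness: "u \<noteq> x" "v \<noteq> x" "x \<notin> P" "u \<notin> P" "v \<notin> P"
  "w \<in> P \<Longrightarrow> w \<notin> pverts K" "w \<in> P \<Longrightarrow> w \<noteq> u" "w \<in> P \<Longrightarrow> w \<noteq> v" "w \<in> P \<Longrightarrow> w \<noteq> x"
  using u v x P by auto

lemmas facts = u v uv uv[symmetric] x distinctness distinctness(7-9)[symmetric]

section \<open>Absence of an opposition\<close>

lemma not_opposable: "\<not> opposable G"
proof
  assume "opposable G"
  then obtain f where bij: "bij_betw f (pverts G) (pverts G)"
    and arc: "\<And>a b. a \<in> pverts G \<Longrightarrow> b \<in> pverts G \<Longrightarrow> (f a, f b) \<in> parcs G \<longleftrightarrow> (a, b) \<in> parcs G"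
    and nbhd: "\<And>a. a \<in> pverts G \<Longrightarrow> f a \<notin> closed_nbhd G a"
    unfolding opposable_def opposition_def automorphism_def by blast
  have "f x \<in> pverts G" "f x \<notin> closed_nbhd G x"
    using bij nbhd by (auto simp: verts_G dest: bij_betwE)
  \<comment> \<open>The closed neighbourhood of \<open>x\<close> leaves out exactly
    \<open>W\<close>.\<close>
  then have fx: "f x \<in> W" by (auto simp: verts_G closed_nbhd_def arcs_G)
  obtain p where p: "p \<in> P" using cardP n by fastforce
  then have "(f p, f x) \<in> parcs G" using arc by (auto simp: verts_G arcs_G)
  then have fp: "f p \<in> pverts K" "f p \<noteq> f x" using fx facts by (auto simp: arcs_G)
  have "card {f x, f p} \<le> 2" by (simp add: card_insert_if)
  \<comment> \<open>\<open>W\<close> has 2n-1 \<ge> 3 vertices. A third one is neither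
    \<open>u\<close> nor \<open>v\<close>, so the missing edge does not keep it from being adjacent
    to \<open>f p\<close>.\<close>
  have "\<not> W \<subseteq> {f x, f p}"
    using cardW n card_mono[of "{f x, f p}" W] \<open>card {f x, f p} \<le> 2\<close> by force
  then obtain b where b: "b \<in> W" "b \<noteq> f x" "b \<noteq> f p" by blast
  then have "b \<in> pverts G" "(f p, b) \<in> parcs G" using fp by (auto simp: verts_G arcs_G)
  \<comment> \<open>The preimage of \<open>b\<close> is a neighbour of the pendant vertex
    \<open>p\<close>, hence equals \<open>x\<close>, although \<open>b \<noteq> f x\<close>.\<close>
  moreover obtain a where "a \<in> pverts G" "b = f a"
    using bij \<open>b \<in> pverts G\<close> by (auto simp: bij_betw_def)
  ultimately have "(p, a) \<in> parcs G" using arc p by (auto simp: verts_G)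
  then have "a = x" using p facts by (auto simp: arcs_G)
  with \<open>b = f a\<close> b show False by simp
qed

section \<open>Openings that lead to balanced positions\<close>

text \<open>\<open>x\<close> closes \<open>P\<close> to \<open>p\<close>, \<open>w\<close> closes
  \<open>W\<close> to \<open>opponent p\<close>, and \<open>u\<close>, \<open>v\<close> are closed
  to both. All remaining moves are private, and \<open>card P = card W - 1\<close> makes the shares
  equal.\<close>

lemma balanced_x_W:
  assumes "w \<in> W"
  shows "balanced G p [x \<mapsto> opponent p, w \<mapsto> p]"
proof -
  have "w \<noteq> x" using assms x by auto
  then have "moves G (opponent p) [x \<mapsto> opponent p, w \<mapsto> p] = P"
    "moves G p [x \<mapsto> opponent p, w \<mapsto> p] = W - {w}"
    using assms by (auto simp: facts moves_def legal_move_update verts_G arcs_G)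
  moreover have "P - (W - {w}) = P" "W - {w} - P = W - {w}" "P \<inter> (W - {w}) = {}"
    using facts by auto
  moreover have "card (W - {w}) = card P"
    using assms cardW cardP finK by (simp add: card_Diff_singleton)
  ultimately show ?thesis
    using facts by (auto simp: balanced_def arcs_G)
qed

lemma balanced_W_x:
  assumes "w \<in> W"
  shows "balanced G p [w \<mapsto> opponent p, x \<mapsto> p]"
proof -
  have "w \<noteq> x" using assms x by auto
  then have "moves G (opponent p) [w \<mapsto> opponent p, x \<mapsto> p] = W - {w}"
    "moves G p [w \<mapsto> opponent p, x \<mapsto> p] = P"
    using assms by (auto simp: facts moves_def legal_move_update verts_G arcs_G)
  moreover have "P - (W - {w}) = P" "W - {w} - P = W - {w}" "(W - {w}) \<inter> P = {}"
    using facts by auto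
  moreover have "card (W - {w}) = card P"
    using assms cardW cardP finK by (simp add: card_Diff_singleton)
  ultimately show ?thesis
    using facts by (auto simp: balanced_def arcs_G)
qed

text \<open>\<open>x\<close> and every vertex of \<open>W\<close> see both colours; only the pendant
  vertices stay open, to both players and in even number.\<close>

lemma balanced_u_v:
  assumes "{a, b} = {u, v}"
  shows "balanced G p [a \<mapsto> opponent p, b \<mapsto> p]"
proof -
  have "a = u \<and> b = v \<or> a = v \<and> b = u" using assms by (auto simp: doubleton_eq_iff)
  then have "moves G (opponent p) [a \<mapsto> opponent p, b \<mapsto> p] = P"
    "moves G p [a \<mapsto> opponent p, b \<mapsto> p] = P"
    by (auto simp: facts moves_def legal_move_update verts_G arcs_G)
  then show ?thesis
    using facts cardP by (auto simp: balanced_def arcs_G)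
qed

lemma card_minus_two_pendants:
  assumes "r \<in> P" "r' \<in> P" "r \<noteq> r'"
  shows "even (card (P - {r, r'}))"
  using assms finP cardP by (subst card_Diff_subset) auto

text \<open>\<open>u\<close> and \<open>v\<close> in different colours again close \<open>W\<close>
  and \<open>x\<close> to both; the second pendant vertex restores the parity.\<close>

lemma balanced_pendant_u_v_pendant:
  assumes "r \<in> P" "r' \<in> P" "r \<noteq> r'"
  shows "balanced G p [r \<mapsto> opponent p, u \<mapsto> p, v \<mapsto> opponent p, r' \<mapsto> p]"
proof -
  have "moves G (opponent p) [r \<mapsto> opponent p, u \<mapsto> p, v \<mapsto> opponent p, r' \<mapsto> p] = P - {r, r'}"
    "moves G p [r \<mapsto> opponent p, u \<mapsto> p, v \<mapsto> opponent p, r' \<mapsto> p] = P - {r, r'}"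
    using assms by (auto simp: facts moves_def legal_move_update verts_G arcs_G)
  then show ?thesis
    using facts card_minus_two_pendants[OF assms] by (auto simp: balanced_def arcs_G)
qed

text \<open>\<open>x\<close> sees both colours, while \<open>W\<close> sees only that of
  \<open>p\<close> and becomes private to \<open>p\<close>. This surplus fits, since balance asks
  for an inequality only.\<close>

lemma balanced_pendant_u_pendant_v:
  assumes "r \<in> P" "r' \<in> P" "r \<noteq> r'"
  shows "balanced G p [r \<mapsto> opponent p, u \<mapsto> p, r' \<mapsto> opponent p, v \<mapsto> p]"
proof -
  have "moves G (opponent p) [r \<mapsto> opponent p, u \<mapsto> p, r' \<mapsto> opponent p, v \<mapsto> p] = P - {r, r'}"
    "moves G p [r \<mapsto> opponent p, u \<mapsto> p, r' \<mapsto> opponent p, v \<mapsto> p] = W \<union> (P - {r, r'})"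
    using assms by (auto simp: facts moves_def legal_move_update verts_G arcs_G)
  moreover have "S - (T \<union> S) = {}" "S \<inter> (T \<union> S) = S" for S T :: "'a set" by auto
  moreover have "\<forall>a\<in>P - {r, r'}. \<forall>b\<in>W \<union> (P - {r, r'}). (a, b) \<notin> parcs G \<and> (b, a) \<notin> parcs G"
    by (auto simp: facts arcs_G)
  ultimately show ?thesis
    using card_minus_two_pendants[OF assms] unfolding balanced_def
    by (simp only: card.empty le0 simp_thms)
qed

section \<open>The replies of the second player\<close>

text \<open>The second alternative is not yet balanced: \<open>v\<close> is open to
  \<open>opponent p\<close> and adjacent to \<open>W\<close>, which is open to \<open>p\<close>. One
  more round settles who gets \<open>v\<close>.\<close>

lemma reply_to_first_move:
  assumes w: "w \<in> pverts G"
  shows "\<exists>z. legal_move G p [w \<mapsto> opponent p] z \<and>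
    (balanced G p [w \<mapsto> opponent p, z \<mapsto> p] \<or> w \<in> P \<and> z = u)"
proof -
  have legal: "legal_move G p [w \<mapsto> opponent p] z"
    if "z \<in> pverts G" "z \<noteq> w" "(z, w) \<notin> parcs G" for z
    using that by (simp add: legal_move_update)
  have "card W \<noteq> 0" using cardW n by simp
  then obtain y where y: "y \<in> W" by (metis all_not_in_conv card.empty)
  consider "w = x" | "w \<in> W" | "w = u" | "w = v" | "w \<in> P" using w by (auto simp: verts_G)
  then show ?thesis
  proof cases
    case 1
    then show ?thesis using y balanced_x_W[OF y] legal[of y] facts
      by (intro exI[of _ y]) (auto simp: verts_G arcs_G)
  next
    case 2
    then show ?thesis using balanced_W_x[OF 2] legal[of x] facts
      by (intro exI[of _ x]) (auto simp: verts_G arcs_G)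
  next
    case 3
    then show ?thesis using balanced_u_v[of u v] legal[of v] facts
      by (intro exI[of _ v]) (auto simp: verts_G arcs_G)
  next
    case 4
    then show ?thesis using balanced_u_v[of v u] legal[of u] facts
      by (intro exI[of _ u]) (auto simp: verts_G arcs_G)
  next
    case 5
    then show ?thesis using legal[of u] facts
      by (intro exI[of _ u]) (auto simp: verts_G arcs_G)
  qed
qed

lemma reply_after_pendant:
  assumes r: "r \<in> P" and w: "legal_move G (opponent p) [r \<mapsto> opponent p, u \<mapsto> p] w"
  shows "\<exists>z. legal_move G p [r \<mapsto> opponent p, u \<mapsto> p, w \<mapsto> opponent p] z \<and>
    balanced G p [r \<mapsto> opponent p, u \<mapsto> p, w \<mapsto> opponent p, z \<mapsto> p]"
proof -
  have "r \<noteq> u" using r facts by auto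
  \<comment> \<open>\<open>u\<close> has closed \<open>x\<close> and \<open>W\<close> to
    \<open>opponent p\<close>, but not \<open>v\<close>, as the edge between them was
    subdivided.\<close>
  then have "w = v \<or> w \<in> P \<and> w \<noteq> r"
    using w facts by (auto simp: legal_move_update verts_G arcs_G)
  then show ?thesis
  proof
    assume "w = v"
    \<comment> \<open>Here \<open>n \<ge> 2\<close> provides at least two pendant vertices.\<close>
    have "\<not> P \<subseteq> {r}" using cardP n card_mono[of "{r}" P] by auto
    then obtain r' where r': "r' \<in> P" "r' \<noteq> r" by blast
    then have "legal_move G p [r \<mapsto> opponent p, u \<mapsto> p, v \<mapsto> opponent p] r'"
      using r facts by (auto simp: legal_move_update verts_G arcs_G)
    with \<open>w = v\<close> r r' show ?thesis
      using balanced_pendant_u_v_pendant[of r r' p] by auto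
  next
    assume "w \<in> P \<and> w \<noteq> r"
    moreover from this have "legal_move G p [r \<mapsto> opponent p, u \<mapsto> p, w \<mapsto> opponent p] v"
      using r facts by (auto simp: legal_move_update verts_G arcs_G)
    ultimately show ?thesis
      using r balanced_pendant_u_pendant_v[of r w p] by auto
  qed
qed

lemma second_player_wins: "second_player_wins_snort G"
  unfolding second_player_wins_snort_def
proof
  fix starter
  define p where "p = opponent starter"
  \<comment> \<open>The disjuncts are the start, the unsettled position after a pendant opening, and
    the counting phase.\<close>
  define I where "I c \<longleftrightarrow> c = Map.empty \<or> (\<exists>r\<in>P. c = [r \<mapsto> opponent p, u \<mapsto> p]) \<or> balanced G p c" for c
  have "\<exists>\<sigma>. strategy_wins G p \<sigma> (opponent p) Map.empty"
  proof (rule ex_winning_strategy[where I = I])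
    show "finite (pverts G)" by (rule finG)
    show "I Map.empty" by (simp add: I_def)
    fix c w assume "I c" and w: "legal_move G (opponent p) c w"
    then consider "c = Map.empty" | r where "r \<in> P" "c = [r \<mapsto> opponent p, u \<mapsto> p]"
      | "balanced G p c"
      by (auto simp: I_def)
    then show "\<exists>z. legal_move G p (c(w \<mapsto> opponent p)) z \<and> I (c(w \<mapsto> opponent p, z \<mapsto> p))"
    proof cases
      case 1
      then show ?thesis using reply_to_first_move[of w p] w unfolding I_def by auto
    next
      case 2
      then show ?thesis using reply_after_pendant[of r p w] w unfolding I_def by blast
    next
      case 3
      then show ?thesis using balanced_reply[OF finG 3 w] unfolding I_def by blast
    qed
  qed
  then show "\<exists>\<sigma>. strategy_wins G (opponent starter) \<sigma> starter Map.empty"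
    by (simp add: p_def)
qed

end

theorem mainTheorem5:
  fixes n :: nat and K :: "'a pair_pre_digraph" and u v x :: 'a and P :: "'a set"
  assumes "n \<ge> 2"
    and "complete_digraph (2 * n + 1) (with_proj K)"
    and "u \<in> pverts K" and "v \<in> pverts K" and "u \<noteq> v"
    and "x \<notin> pverts K"
    and "finite P" and "card P = 2 * n - 2" and "P \<inter> insert x (pverts K) = {}"
  shows "\<not> opposable (pendant_subdivision K u v x P)
    \<and> second_player_wins_snort (pendant_subdivision K u v x P)"
proof -
  interpret complete_pendant_subdivision n K u v x P
    using assms by unfold_locales
  show ?thesis using not_opposable second_player_wins ..
qed

end
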